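(* Let $G=(V,E)$ be a connected, undirected, unweighted graph, $R\subseteq V$ a set of landmarks, $H=(R,\delta_H)$ the highway, and $L$ a highway cover distance labelling over $(G,H)$. For $s,t\in V\setminus R$ let $d^{\top}_{st}=\min\{\delta_L(r_i,s)+\delta_H(r_i,r_j)+\delta_L(r_j,t) : (r_i,\delta_L(r_i,s))\in L(s),\ (r_j,\delta_L(r_j,t))\in L(t)\}$, and let the querying framework return $d_{st}=d_{G[V\setminus R]}(s,t)$ if $d_{G[V\setminus R]}(s,t)\le d^{\top}_{st}$, and $d_{st}=d^{\top}_{st}$ otherwise. Then $d_{st}=d_G(s,t)$ for all $s,t\in V\setminus R$.
   Context: $d_X(u,v)$ denotes the shortest-path distance in a graph $X$ ($\infty$ if no path); $G[V\setminus R]$ is the subgraph induced by $V\setminus R$. A vertex $x$ lies on a shortest path between $u$ and $w$ if $d_G(u,x)+d_G(x,w)=d_G(u,w)$. A highway is a pair $H=(R,\delta_H)$ with $\delta_H(r_1,r_2)=d_G(r_1,r_2)$ for all $r_1,r_2\in R$. A distance labelling assigns to each $v\in V\setminus R$ a label $L(v)$, a set of entries $(r,\delta_L(r,v))$ with $r\in R$ and $\delta_L(r,v)=d_G(r,v)$. It is a highway cover distance labelling over $(G,H)$ if for all $s,t\in V\setminus R$ and every $r\in R$ there exist $(r_i,\delta_L(r_i,s))\in L(s)$ and $(r_j,\delta_L(r_j,t))\in L(t)$ such that $r_i$ lies on a shortest path between $r$ and $s$ and $r_j$ lies on a shortest path between $r$ and $t$ (possibly $r_i=r$ or $r_j=r$).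 *)

theory Defs
  imports "Graph_Theory.Graph_Theory"
begin

(* The library's mu is the infimum of the costs of all walks. With unit costs these are walk
   lengths, so the infimum is attained by a shortest path if there is any walk, and it is
   infinite otherwise. *)
definition gdist :: "('a, 'b) pre_digraph \<Rightarrow> 'a \<Rightarrow> 'a \<Rightarrow> ereal" where
  "gdist X u v = wf_digraph.\<mu> X (\<lambda>_. 1) u v"

definition on_shortest_path :: "('a, 'b) pre_digraph \<Rightarrow> 'a \<Rightarrow> 'a \<Rightarrow> 'a \<Rightarrow> bool" where
  "on_shortest_path X x u w \<longleftrightarrow> gdist X u x + gdist X x w = gdist X u w"

definition highway :: "('a, 'b) pre_digraph \<Rightarrow> 'a set \<Rightarrow> ('a \<Rightarrow> 'a \<Rightarrow> ereal) \<Rightarrow> bool" where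
  "highway X R \<delta>\<^sub>H \<longleftrightarrow>
     R \<subseteq> verts X \<and> (\<forall>r\<^sub>1\<in>R. \<forall>r\<^sub>2\<in>R. \<delta>\<^sub>H r\<^sub>1 r\<^sub>2 = gdist X r\<^sub>1 r\<^sub>2)"

type_synonym 'a labelling = "'a \<Rightarrow> ('a \<times> ereal) set"

definition distance_labelling :: "('a, 'b) pre_digraph \<Rightarrow> 'a set \<Rightarrow> 'a labelling \<Rightarrow> bool" where
  "distance_labelling X R L \<longleftrightarrow>
     (\<forall>v\<in>verts X - R. \<forall>(r, \<delta>)\<in>L v. r \<in> R \<and> \<delta> = gdist X r v)"

definition highway_cover_labelling ::
    "('a, 'b) pre_digraph \<Rightarrow> 'a set \<Rightarrow> ('a \<Rightarrow> 'a \<Rightarrow> ereal) \<Rightarrow> 'a labelling \<Rightarrow> bool" where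
  "highway_cover_labelling X R \<delta>\<^sub>H L \<longleftrightarrow>
     highway X R \<delta>\<^sub>H \<and> distance_labelling X R L \<and>
     (\<forall>s\<in>verts X - R. \<forall>t\<in>verts X - R. \<forall>r\<in>R.
        \<exists>(r\<^sub>i, \<delta>\<^sub>i)\<in>L s. \<exists>(r\<^sub>j, \<delta>\<^sub>j)\<in>L t.
          on_shortest_path X r\<^sub>i r s \<and> on_shortest_path X r\<^sub>j r t)"

(* The minimum is an infimum in the extended reals. All values come from walk lengths, so it
   is attained whenever both labels are nonempty; it is infinite if one of them is empty,
   which for a highway cover labelling happens only if there are no landmarks. *)
definition upper_bound :: "('a \<Rightarrow> 'a \<Rightarrow> ereal) \<Rightarrow> 'a labelling \<Rightarrow> 'a \<Rightarrow> 'a \<Rightarrow> ereal" where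
  "upper_bound \<delta>\<^sub>H L s t =
     Inf {\<delta>\<^sub>i + \<delta>\<^sub>H r\<^sub>i r\<^sub>j + \<delta>\<^sub>j | r\<^sub>i \<delta>\<^sub>i r\<^sub>j \<delta>\<^sub>j. (r\<^sub>i, \<delta>\<^sub>i) \<in> L s \<and> (r\<^sub>j, \<delta>\<^sub>j) \<in> L t}"

definition query ::
    "('a, 'b) pre_digraph \<Rightarrow> 'a set \<Rightarrow> ('a \<Rightarrow> 'a \<Rightarrow> ereal) \<Rightarrow> 'a labelling \<Rightarrow> 'a \<Rightarrow> 'a \<Rightarrow> ereal" where
  "query X R \<delta>\<^sub>H L s t =
     (if gdist (X \<restriction> (verts X - R)) s t \<le> upper_bound \<delta>\<^sub>H L s t
      then gdist (X \<restriction> (verts X - R)) s t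
      else upper_bound \<delta>\<^sub>H L s t)"

end

theory Submission
  imports Defs
begin

text \<open>
  Both candidate values of a query are lengths of walks in \<open>G\<close>, hence at least the distance.
  Conversely, a walk from \<open>s\<close> to \<open>t\<close> either avoids \<open>R\<close> and survives in \<open>G[V \<setminus> R]\<close>, or meets
  some \<open>r \<in> R\<close>; in the latter case the cover property at \<open>r\<close> yields landmarks \<open>r\<^sub>i\<close> and \<open>r\<^sub>j\<close> on
  shortest paths from \<open>r\<close> to \<open>s\<close> and to \<open>t\<close>, and the detour \<open>s, r\<^sub>i, r\<^sub>j, t\<close> is no longer than
  \<open>d(s,r) + d(r,t)\<close> by the triangle inequality.
\<close>

lemma (in wf_digraph) awalk_cost_one: "awalk_cost (\<lambda>_. 1) p = real (length p)"
  by (induct p) auto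

context wf_digraph
begin

lemma gdist_conv_INF: "gdist G u v = (INF p\<in>{p. awalk u p v}. ereal (real (length p)))"
  by (simp add: gdist_def \<mu>_def awalk_cost_one)

lemma gdist_le_length: "awalk u p v \<Longrightarrow> gdist G u v \<le> ereal (real (length p))"
  unfolding gdist_conv_INF by (auto intro: INF_lower)

lemma gdist_greatest:
  "(\<And>p. awalk u p v \<Longrightarrow> x \<le> ereal (real (length p))) \<Longrightarrow> x \<le> gdist G u v"
  unfolding gdist_conv_INF by (auto intro: INF_greatest)

text \<open>Walk lengths are natural numbers, so a nonempty set of them has a least element, and the
  infimum is a minimum.\<close>

lemma gdist_attained:
  assumes "gdist G u v \<noteq> \<infinity>"
  obtains p where "awalk u p v" "gdist G u v = ereal (real (length p))"
proof -
  have "\<exists>p. awalk u p v"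
    \<comment> \<open>Without any walk the infimum ranges over the empty set and equals
      \<infinity>.\<close>
    using assms by (rule contrapos_np) (simp add: gdist_conv_INF top_ereal_def)
  then obtain p where p: "awalk u p v" "\<And>q. awalk u q v \<Longrightarrow> length p \<le> length q"
    using ex_has_least_nat[of "\<lambda>p. awalk u p v" _ length] by blast
  then have "gdist G u v = ereal (real (length p))"
    by (intro antisym gdist_le_length gdist_greatest) auto
  with p(1) show thesis by (rule that)
qed

text \<open>If both summands are finite, shortest walks for them can be concatenated; otherwise the
  right-hand side is \<infinity>.\<close>

lemma gdist_triangle: "gdist G u w \<le> gdist G u v + gdist G v w"
proof (cases "gdist G u v = \<infinity> \<or> gdist G v w = \<infinity>")
  case True
  then show ?thesis by auto
next
  case False
  then obtain p q where p: "awalk u p v" "gdist G u v = ereal (real (length p))"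
    and q: "awalk v q w" "gdist G v w = ereal (real (length q))"
    by (meson gdist_attained)
  from p(1) q(1) have "awalk u (p @ q) w" by (rule awalk_appendI)
  from gdist_le_length[OF this] show ?thesis by (simp add: p q)
qed

text \<open>Cutting the walk at \<open>v\<close> leaves two walks whose lengths add up to that of
  \<open>p\<close>.\<close>

lemma gdist_via_awalk_vertex:
  assumes "awalk u p w" "v \<in> set (awalk_verts u p)"
  shows "gdist G u v + gdist G v w \<le> ereal (real (length p))"
proof -
  obtain q r where "p = q @ r" "awalk u q v" "awalk v r w"
    using awalk_decomp[OF assms] by blast
  then show ?thesis
    using add_mono[OF gdist_le_length[of u q v] gdist_le_length[of v r w]] by simp
qed

text \<open>An arc survives in \<open>G \<restriction> S\<close> exactly if both its ends lie in
  \<open>S\<close>, and the vertices of a nonempty walk are the ends of its arcs.\<close>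

lemma awalk_induce_subgraph_iff:
  assumes "S \<subseteq> verts G"
  shows "pre_digraph.awalk (G \<restriction> S) u p v \<longleftrightarrow> awalk u p v \<and> set (awalk_verts u p) \<subseteq> S"
proof
  assume "pre_digraph.awalk (G \<restriction> S) u p v"
  \<comment> \<open>The conjunct \<open>u \<in> S\<close> takes care of the empty walk, which has no
    arcs.\<close>
  then have "awalk u p v \<and> u \<in> S \<and> (\<forall>e\<in>set p. tail G e \<in> S \<and> head G e \<in> S)"
    using assms
    by (auto simp: pre_digraph.awalk_def compatible_cas[OF compatible_induce_subgraph])
  then show "awalk u p v \<and> set (awalk_verts u p) \<subseteq> S"
    by (auto simp: set_awalk_verts)
next
  assume "awalk u p v \<and> set (awalk_verts u p) \<subseteq> S"
  then show "pre_digraph.awalk (G \<restriction> S) u p v"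
    by (auto simp: set_awalk_verts)
      (auto simp: pre_digraph.awalk_def compatible_cas[OF compatible_induce_subgraph])
qed

text \<open>Walks of the subgraph are walks of \<open>G\<close>, so the infimum for \<open>G\<close>
  ranges over at least as many walks.\<close>

lemma gdist_induce_subgraph_ge:
  assumes "S \<subseteq> verts G"
  shows "gdist G u v \<le> gdist (G \<restriction> S) u v"
proof -
  interpret S: wf_digraph "G \<restriction> S"
    by (rule wellformed_induce_subgraph)
  show ?thesis
    by (rule S.gdist_greatest)
      (simp add: awalk_induce_subgraph_iff[OF assms] gdist_le_length)
qed

lemma gdist_induce_subgraph_le_length:
  assumes "S \<subseteq> verts G" "awalk u p v" "set (awalk_verts u p) \<subseteq> S"
  shows "gdist (G \<restriction> S) u v \<le> ereal (real (length p))"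
proof -
  interpret S: wf_digraph "G \<restriction> S"
    by (rule wellformed_induce_subgraph)
  show ?thesis
    using assms by (intro S.gdist_le_length) (simp add: awalk_induce_subgraph_iff)
qed

end

lemma length_rev_path: "length (rev_path p) = length p"
  by (induct p) auto

text \<open>In a symmetric digraph, reversing a walk gives a walk of the same length.\<close>

lemma (in pair_sym_digraph) gdist_commute: "gdist G u v = gdist G v u"
proof -
  have "gdist G x y \<le> gdist G y x" for x y
  proof (rule gdist_greatest)
    fix p assume "awalk y p x"
    then have "awalk x (rev_path p) y" by simp
    from gdist_le_length[OF this] show "gdist G x y \<le> ereal (real (length p))"
      by (simp add: length_rev_path)
  qed
  then show ?thesis by (intro antisym)
qed

context pair_sym_digraph
begin

context
  fixes R :: "'a set" and \<delta>\<^sub>H :: "'a \<Rightarrow> 'a \<Rightarrow> ereal" and L :: "'a labelling"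
  assumes cover: "highway_cover_labelling G R \<delta>\<^sub>H L"
begin

lemma label_entryD:
  assumes "v \<in> verts G - R" "(r, \<delta>) \<in> L v"
  shows "r \<in> R" "\<delta> = gdist G r v"
  using cover assms by (auto simp: highway_cover_labelling_def distance_labelling_def)

lemma highway_dist: "r \<in> R \<Longrightarrow> r' \<in> R \<Longrightarrow> \<delta>\<^sub>H r r' = gdist G r r'"
  using cover by (auto simp: highway_cover_labelling_def highway_def)

text \<open>By two triangle inequalities, each candidate in the infimum bounds the distance from
  above, being the cost of going \<open>s\<close>, \<open>r\<^sub>i\<close>,
  \<open>r\<^sub>j\<close>, \<open>t\<close>.\<close>

lemma gdist_le_upper_bound:
  assumes s: "s \<in> verts G - R" and t: "t \<in> verts G - R"
  shows "gdist G s t \<le> upper_bound \<delta>\<^sub>H L s t"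
  unfolding upper_bound_def
proof (rule Inf_greatest, clarify)
  fix r\<^sub>i \<delta>\<^sub>i r\<^sub>j \<delta>\<^sub>j
  assume "(r\<^sub>i, \<delta>\<^sub>i) \<in> L s" "(r\<^sub>j, \<delta>\<^sub>j) \<in> L t"
  note i = label_entryD[OF s this(1)] and j = label_entryD[OF t this(2)]
  have "gdist G s t \<le> gdist G s r\<^sub>j + gdist G r\<^sub>j t"
    by (rule gdist_triangle)
  also have "\<dots> \<le> gdist G s r\<^sub>i + gdist G r\<^sub>i r\<^sub>j + gdist G r\<^sub>j t"
    by (intro add_right_mono gdist_triangle)
  finally show "gdist G s t \<le> \<delta>\<^sub>i + \<delta>\<^sub>H r\<^sub>i r\<^sub>j + \<delta>\<^sub>j"
    \<comment> \<open>Labels store the distance from the landmark to \<open>s\<close>, hence the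
      change of direction.\<close>
    by (simp add: i j highway_dist gdist_commute[of s])
qed

lemma upper_bound_le_via_landmark:
  assumes s: "s \<in> verts G - R" and t: "t \<in> verts G - R" and r: "r \<in> R"
  shows "upper_bound \<delta>\<^sub>H L s t \<le> gdist G s r + gdist G r t"
proof -
  have "\<exists>(r\<^sub>i, \<delta>\<^sub>i)\<in>L s. \<exists>(r\<^sub>j, \<delta>\<^sub>j)\<in>L t.
      on_shortest_path G r\<^sub>i r s \<and> on_shortest_path G r\<^sub>j r t"
    using cover s t r unfolding highway_cover_labelling_def by blast
  then obtain r\<^sub>i \<delta>\<^sub>i r\<^sub>j \<delta>\<^sub>j where entries: "(r\<^sub>i, \<delta>\<^sub>i) \<in> L s" "(r\<^sub>j, \<delta>\<^sub>j) \<in> L t"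
    and on_path: "gdist G r r\<^sub>i + gdist G r\<^sub>i s = gdist G r s"
      "gdist G r r\<^sub>j + gdist G r\<^sub>j t = gdist G r t"
    unfolding on_shortest_path_def by fast
  note i = label_entryD[OF s entries(1)] and j = label_entryD[OF t entries(2)]
  have "upper_bound \<delta>\<^sub>H L s t \<le> \<delta>\<^sub>i + \<delta>\<^sub>H r\<^sub>i r\<^sub>j + \<delta>\<^sub>j"
    unfolding upper_bound_def using entries by (intro Inf_lower) blast
  also have "\<dots> = gdist G r\<^sub>i s + gdist G r\<^sub>i r\<^sub>j + gdist G r\<^sub>j t"
    by (simp add: i j highway_dist)
  \<comment> \<open>The highway distance is at most that of the detour through
    \<open>r\<close>.\<close>
  also have "\<dots> \<le> gdist G r\<^sub>i s + (gdist G r\<^sub>i r + gdist G r r\<^sub>j) + gdist G r\<^sub>j t"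
    by (intro add_mono order_refl gdist_triangle)
  \<comment> \<open>Regrouped this way, the summands form the two left-hand sides of
    \<open>on_path\<close>.\<close>
  also have "\<dots> = (gdist G r r\<^sub>i + gdist G r\<^sub>i s) + (gdist G r r\<^sub>j + gdist G r\<^sub>j t)"
    by (simp add: gdist_commute[of r\<^sub>i r] ac_simps)
  also have "\<dots> = gdist G s r + gdist G r t"
    by (simp only: on_path gdist_commute[of s r])
  finally show ?thesis .
qed

lemma query_eq_gdist:
  assumes s: "s \<in> verts G - R" and t: "t \<in> verts G - R"
  shows "query G R \<delta>\<^sub>H L s t = gdist G s t"
proof -
  let ?V = "verts G - R"
  have query_min: "query G R \<delta>\<^sub>H L s t = min (gdist (G \<restriction> ?V) s t) (upper_bound \<delta>\<^sub>H L s t)"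
    by (simp add: query_def min_def)
  show ?thesis
  proof (rule antisym)
    show "gdist G s t \<le> query G R \<delta>\<^sub>H L s t"
      unfolding query_min
      by (rule min.boundedI[OF gdist_induce_subgraph_ge gdist_le_upper_bound[OF s t]]) auto
    show "query G R \<delta>\<^sub>H L s t \<le> gdist G s t"
    \<comment> \<open>Comparing with every walk instead of a shortest one avoids a separate case for
      infinite distance.\<close>
    proof (rule gdist_greatest)
      fix p assume p: "awalk s p t"
      show "query G R \<delta>\<^sub>H L s t \<le> ereal (real (length p))"
      proof (cases "set (awalk_verts s p) \<subseteq> ?V")
        case True
        with p have "gdist (G \<restriction> ?V) s t \<le> ereal (real (length p))"
          by (intro gdist_induce_subgraph_le_length) auto
        then show ?thesis unfolding query_min by (rule min.coboundedI1)
      next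
        case False
        \<comment> \<open>All vertices of \<open>p\<close> lie in \<open>G\<close>, so one outside
          \<open>?V\<close> must be a landmark.\<close>
        with p obtain r where r: "r \<in> set (awalk_verts s p)" "r \<in> R" by (auto elim!: awalkE')
        have "upper_bound \<delta>\<^sub>H L s t \<le> gdist G s r + gdist G r t"
          by (rule upper_bound_le_via_landmark[OF s t r(2)])
        also have "\<dots> \<le> ereal (real (length p))"
          by (rule gdist_via_awalk_vertex[OF p r(1)])
        finally show ?thesis unfolding query_min by (rule min.coboundedI2)
      qed
    qed
  qed
qed

end

end

theorem theorem4p6:
  fixes G :: "'a pair_pre_digraph"
    and R :: "'a set"
    and \<delta>\<^sub>H :: "'a \<Rightarrow> 'a \<Rightarrow> ereal"
    and L :: "'a labelling"
  assumes "pair_sym_digraph G"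
    and "Digraph_Component.connected (with_proj G)"
    and "R \<subseteq> pverts G"
    and "highway (with_proj G) R \<delta>\<^sub>H"
    and "highway_cover_labelling (with_proj G) R \<delta>\<^sub>H L"
  shows "\<forall>s\<in>pverts G - R. \<forall>t\<in>pverts G - R.
           query (with_proj G) R \<delta>\<^sub>H L s t = gdist (with_proj G) s t"
  using pair_sym_digraph.query_eq_gdist[OF assms(1,5)] by simp

end
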